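(* Let $X$ be a Polish metric space. The following assertions are equivalent: (a) $E(X)=\overline{E(X,\omega)}$. (b) $E(X)$ is separable. (c) $X$ is Heine-Borel and for every $\delta>0$ and every sequence $(x_n)_{n\in\mathbb N}$ of points of $X$ there exists $N\in\mathbb N$ such that for all $n\ge N$ there exists $i$ with $1\le i\le N$ and $d(x_0,x_n)\ge d(x_0,x_i)+d(x_i,x_n)-\delta$. (d) Any sequence of points of $X$ admits an inline subsequence.
   Context: A Polish metric space is a complete separable metric space; it is Heine-Borel if its closed bounded balls are compact. $E(X)$ is the set of Katětov maps on $(X,d)$, i.e. maps $f\colon X\to\mathbb R$ with $|f(x)-f(y)|\le d(x,y)\le f(x)+f(y)$ for all $x,y\in X$, endowed with the sup-metric. $E(X,\omega)$ is the set of $f\in E(X)$ that are controlled by some finite $S\subseteq X$, meaning $f(x)=\inf\{f(s)+d(x,s)\colon s\in S\}$ for all $x\in X$; the closure in (a) is taken in $E(X)$. For $\varepsilon>0$, a sequence $(u_n)_{n\in\mathbb N}$ in $X$ is $\varepsilon$-good-inline if for every integer $r\ge 0$, $\sum_{i=0}^r d(u_i,u_{i+1})\le d(u_0,u_{r+1})+\varepsilon$. A sequence $(u_n)_{n\in\mathbb N}$ is inline if for every $\varepsilon>0$ there exists $N\ge0$ such that $(u_{n+N})_{n\in\mathbb N}$ is $\varepsilon$-good-inline. *)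

theory Defs
  imports "HOL-Analysis.Analysis"
begin

definition katetov :: "('a::metric_space \<Rightarrow> real) set" where
  "katetov = {f. \<forall>x y. \<bar>f x - f y\<bar> \<le> dist x y \<and> dist x y \<le> f x + f y}"

text \<open>Katetov maps may be unbounded, but the difference of two of them is bounded, so on
  \<^const>\<open>katetov\<close> the supremum below is a genuine one. The value \<open>0\<close> elsewhere only serves the locale
  \<^locale>\<open>Metric_space\<close>, which demands nonnegativity of the distance outside the carrier as well.\<close>

definition katetov_dist :: "('a::metric_space \<Rightarrow> real) \<Rightarrow> ('a \<Rightarrow> real) \<Rightarrow> real" where
  "katetov_dist f g = (if f \<in> katetov \<and> g \<in> katetov then SUP x. \<bar>f x - g x\<bar> else 0)"

abbreviation katetov_topology :: "('a::metric_space \<Rightarrow> real) topology" where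
  "katetov_topology \<equiv> Metric_space.mtopology katetov katetov_dist"

text \<open>The infimum over the empty set is \<open>\<infinity>\<close> in the mathematical convention, so the empty set controls
  no real-valued map on a nonempty space. As \<open>Inf {} :: real\<close> is an unspecified real number, the empty
  set has to be excluded explicitly.\<close>

definition controlled_by :: "('a::metric_space \<Rightarrow> real) \<Rightarrow> 'a set \<Rightarrow> bool" where
  "controlled_by f S \<longleftrightarrow> S \<noteq> {} \<and> (\<forall>x. f x = (INF s\<in>S. f s + dist x s))"

definition katetov_finite :: "('a::metric_space \<Rightarrow> real) set" where
  "katetov_finite = {f \<in> katetov. \<exists>S. finite S \<and> controlled_by f S}"

definition good_inline :: "real \<Rightarrow> (nat \<Rightarrow> 'a::metric_space) \<Rightarrow> bool" where
  "good_inline \<epsilon> u \<longleftrightarrow> (\<forall>r. (\<Sum>i=0..r. dist (u i) (u (i + 1))) \<le> dist (u 0) (u (r + 1)) + \<epsilon>)"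

definition inline_seq :: "(nat \<Rightarrow> 'a::metric_space) \<Rightarrow> bool" where
  "inline_seq u \<longleftrightarrow> (\<forall>\<epsilon>>0. \<exists>N. good_inline \<epsilon> (\<lambda>n. u (n + N)))"

lemma katetov_diff_le:
  assumes "f \<in> katetov" "g \<in> katetov"
  shows "\<bar>f x - g x\<bar> \<le> f z + g z"
proof -
  have "\<bar>f x - f z\<bar> \<le> dist x z" "dist x z \<le> f x + f z"
       "\<bar>g x - g z\<bar> \<le> dist x z" "dist x z \<le> g x + g z"
    using assms by (auto simp: katetov_def)
  then show ?thesis by linarith
qed

lemma bdd_above_katetov_diff:
  assumes "f \<in> katetov" "g \<in> katetov"
  shows "bdd_above (range (\<lambda>x. \<bar>f x - g x\<bar>))"
  using katetov_diff_le[OF assms] by (intro bdd_aboveI2)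

lemma katetov_dist_upper:
  assumes "f \<in> katetov" "g \<in> katetov"
  shows "\<bar>f x - g x\<bar> \<le> katetov_dist f g"
  using cSUP_upper[OF UNIV_I bdd_above_katetov_diff[OF assms]] assms
  by (simp add: katetov_dist_def)

lemma katetov_dist_least:
  assumes "f \<in> katetov" "g \<in> katetov" "\<And>x. \<bar>f x - g x\<bar> \<le> c"
  shows "katetov_dist f g \<le> c"
  using assms by (auto simp: katetov_dist_def intro: cSUP_least)

lemma Metric_space_katetov: "Metric_space katetov katetov_dist"
proof
  show "katetov_dist f g = katetov_dist g f" for f g :: "'a \<Rightarrow> real"
    by (auto simp: katetov_dist_def abs_minus_commute)
  show "0 \<le> katetov_dist f g" for f g :: "'a \<Rightarrow> real"
  proof (cases "f \<in> katetov \<and> g \<in> katetov")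
    case True
    then show ?thesis
      using katetov_dist_upper[of f g] by (meson abs_ge_zero order_trans)
  qed (auto simp: katetov_dist_def)
  fix f g h :: "'a \<Rightarrow> real"
  assume f: "f \<in> katetov" and g: "g \<in> katetov"
  show "katetov_dist f g = 0 \<longleftrightarrow> f = g"
  proof
    assume "katetov_dist f g = 0"
    then show "f = g"
      using katetov_dist_upper[OF f g] by (auto simp: fun_eq_iff)
  qed (simp add: katetov_dist_def)
  assume h: "h \<in> katetov"
  show "katetov_dist f h \<le> katetov_dist f g + katetov_dist g h"
  proof (rule katetov_dist_least[OF f h])
    show "\<bar>f x - h x\<bar> \<le> katetov_dist f g + katetov_dist g h" for x
      using katetov_dist_upper[OF f g, of x] katetov_dist_upper[OF g h, of x] by linarith
  qed
qed

end

theory Submission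
  imports Defs
begin

text \<open>The proof is the cycle (a) \<open>\<Rightarrow>\<close> (b) \<open>\<Rightarrow>\<close> second half of (c) \<open>\<Rightarrow>\<close> (d) \<open>\<Rightarrow>\<close> (a), together with (d) \<open>\<Rightarrow>\<close>
  Heine-Borel: a bounded inline sequence has finite length, hence converges. If the second half of
  (c) fails at \<open>\<delta>\<close>, some point \<open>p\<close> and sequence \<open>y\<close> satisfy
  \<open>dist p (y j) < dist p (y i) + dist (y i) (y j) - \<delta>\<close> for \<open>i < j\<close>, and lowering the map
  \<open>y i \<mapsto> dist p (y i) + \<delta>/3\<close> by \<open>\<delta>/3\<close> at an arbitrary set of indices yields uncountably many
  Katetov maps at mutual distance at least \<open>\<delta>/3\<close>. If it holds, the pigeonhole principle selects a subsequence along
  which the triangle inequality is an equality up to summable errors. Finally, a Katetov map \<open>f\<close> at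
  distance more than \<open>\<epsilon>\<close> from all finitely controlled maps yields a sequence with
  \<open>f (u n) + \<epsilon> < f (u i) + dist (u n) (u i)\<close> for \<open>i < n\<close>; along an inline subsequence the gains \<open>\<epsilon>\<close>
  add up and contradict \<open>dist (u 0) (u n) \<le> f (u 0) + f (u n)\<close>.\<close>

section \<open>Closures in the sup-metric, and Katetov maps built from prescribed values\<close>

interpretation katetov: Metric_space "katetov :: ('a::metric_space \<Rightarrow> real) set" katetov_dist
  by (rule Metric_space_katetov)

lemma in_katetov_closure_iff:
  fixes A :: "('a::metric_space \<Rightarrow> real) set"
  assumes "A \<subseteq> katetov"
  shows "f \<in> katetov_topology closure_of A \<longleftrightarrow>
    f \<in> katetov \<and> (\<forall>e>0. \<exists>g\<in>A. \<forall>x. \<bar>f x - g x\<bar> \<le> e)"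
proof (cases "f \<in> katetov")
  case True
  have "(\<exists>g\<in>A. g \<in> katetov.mball f e) \<longrightarrow> (\<exists>g\<in>A. \<forall>x. \<bar>f x - g x\<bar> \<le> e)" for e
    by (simp add: katetov.in_mball) (meson katetov_dist_upper less_imp_le order_trans)
  \<comment> \<open>Halving \<open>e\<close> turns the non-strict pointwise bound into membership in
    the open ball.\<close>
  moreover have "(\<exists>g\<in>A. \<forall>x. \<bar>f x - g x\<bar> \<le> e / 2) \<longrightarrow> (\<exists>g\<in>A. g \<in> katetov.mball f e)" if "e > 0" for e
  proof (intro impI, elim bexE)
    fix g assume g: "g \<in> A" "\<forall>x. \<bar>f x - g x\<bar> \<le> e / 2"
    then have "katetov_dist f g \<le> e / 2"
      using True assms by (intro katetov_dist_least) auto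
    then show "\<exists>g\<in>A. g \<in> katetov.mball f e"
      using True g assms that by (intro bexI[of _ g]) auto
  qed
  ultimately have "(\<forall>e>0. \<exists>g\<in>A. g \<in> katetov.mball f e) \<longleftrightarrow> (\<forall>e>0. \<exists>g\<in>A. \<forall>x. \<bar>f x - g x\<bar> \<le> e)"
    by (meson half_gt_zero)
  then show ?thesis
    using True by (simp add: katetov.metric_closure_of)
qed (simp add: katetov.metric_closure_of)

text \<open>For nonempty \<open>I\<close> and nonnegative \<open>v\<close>, this is the largest
  1-Lipschitz map whose value at each \<open>p i\<close> is at most \<open>v i\<close>. Indexing by
  \<open>I\<close> lets points repeat, so a set of pairs (point, value) serves as data through
  \<open>fst\<close> and \<open>snd\<close>.\<close>

definition katetov_hull :: "'i set \<Rightarrow> ('i \<Rightarrow> 'a::metric_space) \<Rightarrow> ('i \<Rightarrow> real) \<Rightarrow> 'a \<Rightarrow> real" where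
  "katetov_hull I p v x = (INF i\<in>I. v i + dist x (p i))"

context
  fixes I :: "'i set" and p :: "'i \<Rightarrow> 'a::metric_space" and v :: "'i \<Rightarrow> real"
  assumes ne: "I \<noteq> {}" and dist_le: "\<And>i j. i \<in> I \<Longrightarrow> j \<in> I \<Longrightarrow> dist (p i) (p j) \<le> v i + v j"
begin

lemma katetov_hull_nonneg: "i \<in> I \<Longrightarrow> 0 \<le> v i"
  using dist_le[of i i] by simp

lemma katetov_hull_le: "i \<in> I \<Longrightarrow> katetov_hull I p v x \<le> v i + dist x (p i)"
  unfolding katetov_hull_def
  by (rule cINF_lower) (auto intro!: bdd_belowI2[of _ 0] add_nonneg_nonneg katetov_hull_nonneg)

lemma katetov_hull_greatest: "(\<And>i. i \<in> I \<Longrightarrow> c \<le> v i + dist x (p i)) \<Longrightarrow> c \<le> katetov_hull I p v x"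
  unfolding katetov_hull_def using ne by (rule cINF_greatest)

text \<open>An infimum of 1-Lipschitz maps is 1-Lipschitz. For the lower bound, go from
  \<open>x\<close> to \<open>y\<close> through \<open>p i\<close> and \<open>p j\<close>, bound the
  middle leg by \<open>v i + v j\<close>, and take the infima over \<open>i\<close> and
  \<open>j\<close> one after the other.\<close>

lemma katetov_hull_in_katetov: "katetov_hull I p v \<in> katetov"
proof -
  have lip: "katetov_hull I p v x - dist x y \<le> katetov_hull I p v y" for x y
  proof (rule katetov_hull_greatest)
    show "katetov_hull I p v x - dist x y \<le> v i + dist y (p i)" if "i \<in> I" for i
      using katetov_hull_le[OF that, of x] dist_triangle[of x "p i" y] by linarith
  qed
  have "dist x y - katetov_hull I p v x \<le> katetov_hull I p v y" for x y
  proof (rule katetov_hull_greatest)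
    fix j assume j: "j \<in> I"
    have "dist x y - (v j + dist y (p j)) \<le> katetov_hull I p v x"
    proof (rule katetov_hull_greatest)
      fix i assume i: "i \<in> I"
      show "dist x y - (v j + dist y (p j)) \<le> v i + dist x (p i)"
        using dist_le[OF i j] dist_triangle[of x y "p i"] dist_triangle[of "p i" y "p j"]
        by (simp add: dist_commute)
    qed
    then show "dist x y - katetov_hull I p v x \<le> v j + dist y (p j)"
      by linarith
  qed
  then show ?thesis
    using lip by (simp add: katetov_def abs_le_iff) (smt (verit) dist_commute)
qed

lemma katetov_hull_eq:
  assumes "i \<in> I" "\<And>j. j \<in> I \<Longrightarrow> v i \<le> v j + dist (p i) (p j)"
  shows "katetov_hull I p v (p i) = v i"
  using katetov_hull_le[OF assms(1), of "p i"] katetov_hull_greatest[of "v i" "p i"] assms(2)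
  by (intro antisym) auto

end

text \<open>Since \<open>f\<close> is 1-Lipschitz, the hull of its restriction to \<open>S\<close>
  agrees with \<open>f\<close> on \<open>S\<close>; replacing \<open>f s\<close> by the hull at
  \<open>s\<close> in the infimum shows that the hull is controlled by \<open>S\<close>.\<close>

lemma katetov_hull_self_in_katetov_finite:
  assumes f: "f \<in> katetov" and S: "finite S" "S \<noteq> {}"
  shows "katetov_hull S id f \<in> katetov_finite"
proof -
  have hyp: "dist (id s) (id t) \<le> f s + f t" for s t
    using f by (simp add: katetov_def)
  have "f s \<le> f t + dist s t" for s t
    using f by (auto simp: katetov_def abs_le_iff algebra_simps)
  then have "katetov_hull S id f s = f s" if "s \<in> S" for s
    using katetov_hull_eq[of S id f s, OF S(2) hyp that] by simp
  then have "controlled_by (katetov_hull S id f) S"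
    using S by (simp add: controlled_by_def katetov_hull_def cong: INF_cong_simp)
  then show ?thesis
    using S katetov_hull_in_katetov[of S id f, OF S(2) hyp] by (auto simp: katetov_finite_def)
qed

section \<open>(a) implies (b): a countable dense set from rational data\<close>

lemma separable_katetov_of_dense_finite:
  assumes dense: "(katetov :: ('a::polish_space \<Rightarrow> real) set) = katetov_topology closure_of katetov_finite"
  shows "separable_space (katetov_topology :: ('a \<Rightarrow> real) topology)"
proof -
  obtain D :: "'a set" where D: "countable D"
    and dD: "\<And>U. open U \<Longrightarrow> U \<noteq> {} \<Longrightarrow> \<exists>d\<in>D. d \<in> U"
    using countable_dense_setE by blast
  \<comment> \<open>The finite data sets are arbitrary, so the intersection keeps only those hulls
    that are Katetov.\<close>
  define C where "C = katetov \<inter> (\<lambda>F. katetov_hull F fst snd) ` {F. finite F \<and> F \<subseteq> D \<times> \<rat>}"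
  have "countable C"
    unfolding C_def by (intro countable_Int2 countable_image countable_Collect_finite_subset
        countable_SIGMA D countable_rat)
  have CK: "C \<subseteq> katetov"
    by (auto simp: C_def)
  have "katetov_finite \<subseteq> katetov_topology closure_of C"
  proof
    fix f :: "'a \<Rightarrow> real" assume "f \<in> katetov_finite"
    then obtain S where f: "f \<in> katetov" and S: "finite S" "S \<noteq> {}"
      and fS: "\<And>x. f x = (INF s\<in>S. f s + dist x s)"
      by (auto simp: katetov_finite_def controlled_by_def)
    have hyp: "dist (id s) (id t) \<le> f s + f t" for s t
      using f by (simp add: katetov_def)
    have f_hull: "f = katetov_hull S id f"
      by (rule ext) (simp add: katetov_hull_def fS[symmetric])
    show "f \<in> katetov_topology closure_of C"
      unfolding in_katetov_closure_iff[OF CK]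
    proof (intro conjI f allI impI)
      fix e :: real assume "e > 0"
      \<comment> \<open>Raising the value by more than \<open>e / 3\<close> pays for moving the
        point by less than \<open>e / 3\<close>: the new data still satisfy the Katetov condition
        and lie above \<open>f\<close>. The upper bound \<open>2 * e / 3\<close> keeps the total
        error within \<open>e\<close>.\<close>
      have "\<exists>d q. d \<in> D \<and> q \<in> \<rat> \<and> dist s d < e / 3 \<and> f s + e / 3 < q \<and> q < f s + 2 * e / 3" for s
        using dD[of "ball s (e / 3)"] Rats_dense_in_real[of "f s + e / 3" "f s + 2 * e / 3"] \<open>e > 0\<close>
        by auto
      then obtain d q where d: "\<And>s. d s \<in> D" "\<And>s. dist s (d s) < e / 3"
        and q: "\<And>s. q s \<in> \<rat>" "\<And>s. f s + e / 3 < q s" "\<And>s. q s < f s + 2 * e / 3"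
        by metis
      define F where "F = (\<lambda>s. (d s, q s)) ` S"
      define g where "g = katetov_hull F fst snd"
      have F: "F \<noteq> {}" "finite F" "F \<subseteq> D \<times> \<rat>"
        using S d q by (auto simp: F_def)
      have tri: "f s + dist x s \<le> q s + dist x (d s)" "q s + dist x (d s) \<le> f s + dist x s + e" for s x
        using d(2)[of s] q(2,3)[of s] dist_triangle[of x s "d s"] dist_triangle[of x "d s" s]
        by (auto simp: dist_commute)
      have hypF: "dist (fst i) (fst j) \<le> snd i + snd j" if "i \<in> F" "j \<in> F" for i j
      proof -
        obtain s t where "i = (d s, q s)" "j = (d t, q t)"
          using \<open>i \<in> F\<close> \<open>j \<in> F\<close> by (auto simp: F_def)
        then show ?thesis
          using dist_triangle[of "d s" "d t" s] dist_triangle[of s "d t" t] hyp[of s t]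
            d(2)[of s] d(2)[of t] q(2)[of s] q(2)[of t] by (simp add: dist_commute)
      qed
      have "f x \<le> g x" for x
        unfolding g_def
      proof (rule katetov_hull_greatest[of F fst snd, OF F(1) hypF])
        show "f x \<le> snd i + dist x (fst i)" if "i \<in> F" for i
          using that katetov_hull_le[of S id f _ x, OF S(2) hyp, folded f_hull] tri(1)[of _ x]
          by (fastforce simp: F_def intro: order_trans)
      qed
      moreover have "g x - e \<le> katetov_hull S id f x" for x
      proof (rule katetov_hull_greatest[of S id f, OF S(2) hyp])
        fix s assume "s \<in> S"
        then have "(d s, q s) \<in> F"
          by (simp add: F_def)
        from katetov_hull_le[of F fst snd _ x, OF F(1) hypF this]
        show "g x - e \<le> f s + dist x (id s)"
          using tri(2)[of s x] by (simp add: g_def)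
      qed
      ultimately have "\<forall>x. \<bar>f x - g x\<bar> \<le> e"
        using \<open>e > 0\<close> by (simp add: abs_le_iff algebra_simps flip: f_hull)
      moreover have "g \<in> C"
        unfolding C_def g_def using katetov_hull_in_katetov[of F fst snd, OF F(1) hypF] F(2,3)
        by (intro IntI imageI CollectI conjI)
      ultimately show "\<exists>g\<in>C. \<forall>x. \<bar>f x - g x\<bar> \<le> e" ..
    qed
  qed
  then have "katetov \<subseteq> katetov_topology closure_of C"
    using dense closure_of_minimal[OF _ closedin_closure_of] by metis
  then have "katetov_topology closure_of C = katetov"
    using closure_of_subset_topspace by fastforce
  then show ?thesis
    using \<open>countable C\<close> CK by (auto simp: separable_space_def)
qed

section \<open>(b) implies the second half of (c): an uncountable separated family\<close>

lemma almost_mono_subseq: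
  fixes a :: "nat \<Rightarrow> real"
  assumes a: "\<And>n. 0 \<le> a n" and "\<eta> > 0"
  shows "\<exists>k :: nat \<Rightarrow> nat. strict_mono k \<and> (\<forall>i j. i \<le> j \<longrightarrow> a (k i) \<le> a (k j) + \<eta>)"
proof -
  obtain r where r: "strict_mono r" "monoseq (a \<circ> r)"
    using seq_monosub[of a] by (auto simp: comp_def)
  show ?thesis
  proof (cases "incseq (a \<circ> r)")
    case True
    then have "a (r i) \<le> a (r j) + \<eta>" if "i \<le> j" for i j
      using incseqD[OF True that] \<open>\<eta> > 0\<close> by simp
    with r show ?thesis by blast
  next
    case False
    \<comment> \<open>A decreasing sequence of nonnegative numbers converges, so its terms from some
      \<open>M\<close> on differ by less than \<open>\<eta>\<close>.\<close>
    then have "decseq (a \<circ> r)"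
      using r(2) by (auto simp: monoseq_iff)
    then obtain L where "(a \<circ> r) \<longlonglongrightarrow> L"
      by (rule decseq_convergent[of "a \<circ> r" 0]) (use a in auto)
    then have "Cauchy (a \<circ> r)"
      by (rule LIMSEQ_imp_Cauchy)
    then obtain M where M: "\<And>m n. m \<ge> M \<Longrightarrow> n \<ge> M \<Longrightarrow> dist (a (r m)) (a (r n)) < \<eta>"
      using \<open>\<eta> > 0\<close> unfolding Cauchy_def by force
    have "a (r (i + M)) \<le> a (r (j + M)) + \<eta>" for i j
      using M[of "i + M" "j + M"] by (auto simp: dist_real_def)
    moreover have "strict_mono (\<lambda>i. r (i + M))"
      using r(1) by (simp add: strict_mono_def)
    ultimately show ?thesis
      by (intro exI[of _ "\<lambda>i. r (i + M)"]) simp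
  qed
qed

lemma not_separable_katetov:
  fixes y :: "nat \<Rightarrow> 'a::metric_space"
  assumes "\<delta> > 0" and y: "\<And>i j. i < j \<Longrightarrow> dist p (y j) < dist p (y i) + dist (y i) (y j) - \<delta>"
  shows "\<not> separable_space (katetov_topology :: ('a \<Rightarrow> real) topology)"
proof
  assume "separable_space (katetov_topology :: ('a \<Rightarrow> real) topology)"
  then obtain C :: "('a \<Rightarrow> real) set" where C: "countable C" "C \<subseteq> katetov"
      "katetov_topology closure_of C = katetov"
    by (auto simp: separable_space_def)
  define \<eta> where "\<eta> = \<delta> / 3"
  have "\<eta> > 0"
    using \<open>\<delta> > 0\<close> by (simp add: \<eta>_def)
  obtain k :: "nat \<Rightarrow> nat" where k: "strict_mono k"
    "\<And>i j. i \<le> j \<Longrightarrow> dist p (y (k i)) \<le> dist p (y (k j)) + \<eta>"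
    using almost_mono_subseq[of "\<lambda>n. dist p (y n)" \<eta>] \<open>\<eta> > 0\<close> by auto
  define z where "z = y \<circ> k"
  have z: "dist p (z j) < dist p (z i) + dist (z i) (z j) - 3 * \<eta>"
          "dist p (z i) \<le> dist p (z j) + \<eta>" if "i < j" for i j
    using y[OF strict_monoD[OF k(1) that]] k(2)[of i j] that by (auto simp: z_def \<eta>_def)
  define v where "v A i = dist p (z i) + (if i \<in> A then 0 else \<eta>)" for A i
  have hyp: "dist (z i) (z j) \<le> v A i + v A j" for A i j
    using dist_triangle3[of "z i" "z j" p] \<open>\<eta> > 0\<close> by (auto simp: v_def)
  \<comment> \<open>For \<open>i < j\<close>, the gap \<open>3 * \<eta>\<close> and almost
    monotonicity give \<open>dist (z i) (z j) > 2 * \<eta>\<close>, which covers a drop of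
    \<open>\<eta>\<close> in the distance to \<open>p\<close> and a further \<open>\<eta>\<close>
    from membership in \<open>A\<close>. For \<open>j < i\<close> the gap alone suffices.\<close>
  have v_lip: "v A i \<le> v A j + dist (z i) (z j)" for A i j
    using z(1,2)[of i j] z(1,2)[of j i] \<open>\<eta> > 0\<close>
    by (cases i j rule: linorder_cases) (auto simp: v_def dist_commute)
  define f where "f A = katetov_hull UNIV z (v A)" for A
  have fK: "f A \<in> katetov" for A
    unfolding f_def by (rule katetov_hull_in_katetov) (auto intro: hyp)
  have fz: "f A (z i) = v A i" for A i
    unfolding f_def by (rule katetov_hull_eq) (auto intro: hyp v_lip)
  \<comment> \<open>Two maps sharing an approximant within \<open>\<eta> / 3\<close> differ by at
    most \<open>2 * \<eta> / 3\<close> everywhere, whereas \<open>f A\<close> and \<open>f B\<close>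
    differ by \<open>\<eta>\<close> at any \<open>z i\<close> with \<open>i\<close> in exactly one
    of \<open>A\<close>, \<open>B\<close>.\<close>
  have "\<exists>g\<in>C. \<forall>x. \<bar>f A x - g x\<bar> \<le> \<eta> / 3" for A
    using fK[of A] in_katetov_closure_iff[OF C(2), of "f A"] \<open>\<eta> > 0\<close> unfolding C(3)
    by (meson divide_pos_pos zero_less_numeral)
  then obtain g where g: "\<And>A. g A \<in> C" "\<And>A x. \<bar>f A x - g A x\<bar> \<le> \<eta> / 3"
    by metis
  have "inj g"
  proof (rule injI, rule ccontr)
    fix A B assume gAB: "g A = g B" and "A \<noteq> B"
    then obtain i where "i \<in> A \<longleftrightarrow> i \<notin> B" by blast
    then have "\<bar>v A i - v B i\<bar> = \<eta>"
      using \<open>\<eta> > 0\<close> by (auto simp: v_def)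
    then show False
      using g(2)[of A "z i"] g(2)[of B "z i"] \<open>\<eta> > 0\<close> unfolding gAB fz by linarith
  qed
  moreover have "countable (range g)"
    using g(1) C(1) by (auto intro: countable_subset[of "range g" C])
  ultimately have "countable (UNIV :: nat set set)"
    using countable_image_inj_on by blast
  then show False
    using Cantors_theorem[of "UNIV :: nat set"] uncountable_def[of "UNIV :: nat set set"] by simp
qed

text \<open>The second half of (c). The condition concerns the whole space, so the
  \<open>itself\<close> argument serves to fix the type.\<close>

definition almost_between :: "'a::metric_space itself \<Rightarrow> bool" where
  "almost_between _ \<longleftrightarrow> (\<forall>\<delta>>0. \<forall>x :: nat \<Rightarrow> 'a. \<exists>N. \<forall>n\<ge>N. \<exists>i. 1 \<le> i \<and> i \<le> N \<and>
     dist (x 0) (x n) \<ge> dist (x 0) (x i) + dist (x i) (x n) - \<delta>)"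

lemma almost_between_of_separable_katetov:
  assumes sep: "separable_space (katetov_topology :: ('a::metric_space \<Rightarrow> real) topology)"
  shows "almost_between TYPE('a)"
proof (rule ccontr)
  assume "\<not> almost_between TYPE('a)"
  then obtain \<delta> and x :: "nat \<Rightarrow> 'a" where "\<delta> > 0" and "\<forall>N. \<exists>n\<ge>N. \<forall>i. 1 \<le> i \<and> i \<le> N \<longrightarrow>
      dist (x 0) (x n) < dist (x 0) (x i) + dist (x i) (x n) - \<delta>"
    unfolding almost_between_def by (meson not_le)
  then obtain \<phi> where \<phi>: "\<And>N. \<phi> N \<ge> N"
    and far: "\<And>N i. 1 \<le> i \<Longrightarrow> i \<le> N \<Longrightarrow>
      dist (x 0) (x (\<phi> N)) < dist (x 0) (x i) + dist (x i) (x (\<phi> N)) - \<delta>"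
    by metis
  \<comment> \<open>The iteration starts at 1 because \<open>far\<close> asks for
    \<open>1 \<le> i\<close>. For \<open>i < j\<close>, monotonicity gives
    \<open>m i \<le> m (j - 1)\<close>, so \<open>far\<close> applies with
    \<open>N = m (j - 1)\<close>, whose image under \<open>\<phi>\<close> is
    \<open>m j\<close>.\<close>
  define m where "m j = (\<phi> ^^ j) 1" for j
  have m_Suc: "m (Suc j) = \<phi> (m j)" for j
    by (simp add: m_def)
  have "mono m"
    using \<phi> by (intro incseq_SucI) (simp add: m_Suc)
  have "1 \<le> m j" for j
    using monoD[OF \<open>mono m\<close>, of 0 j] by (simp add: m_def)
  then have "dist (x 0) (x (m j)) < dist (x 0) (x (m i)) + dist (x (m i)) (x (m j)) - \<delta>"
    if "i < j" for i j
    using that monoD[OF \<open>mono m\<close>, of i "j - 1"] far[of "m i" "m (j - 1)"] m_Suc[of "j - 1"] by simp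
  then have "\<not> separable_space (katetov_topology :: ('a \<Rightarrow> real) topology)"
    using not_separable_katetov[of \<delta> "x 0" "\<lambda>j. x (m j)"] \<open>\<delta> > 0\<close> by simp
  then show False
    using sep by simp
qed

section \<open>The second half of (c) implies (d): extracting an inline subsequence\<close>

lemma almost_between_infinite:
  fixes x :: "nat \<Rightarrow> 'a::metric_space"
  assumes "almost_between TYPE('a)" "infinite A" "\<delta> > 0"
  obtains n' A' where "n' \<in> A" "n < n'" "infinite A'" "A' \<subseteq> A"
    "\<And>l. l \<in> A' \<Longrightarrow> dist (x n) (x n') + dist (x n') (x l) \<le> dist (x n) (x l) + \<delta>"
proof -
  define e where "e = enumerate (A \<inter> {n<..})"
  have "infinite (A - {..n})"
    using assms(2) by (simp add: Diff_infinite_finite)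
  moreover have "A - {..n} = A \<inter> {n<..}"
    by auto
  ultimately have inf: "infinite (A \<inter> {n<..})"
    by simp
  then have e: "e k \<in> A" "n < e k" and inj: "inj e" for k
    using enumerate_in_set[of "A \<inter> {n<..}" k] strict_mono_enumerate[OF inf]
    by (auto simp: e_def strict_mono_imp_inj_on)
  \<comment> \<open>Position 0 holds the base point \<open>x n\<close>; the candidates beyond
    \<open>n\<close> are thereby shifted by one, whence \<open>e (k - 1)\<close> below.\<close>
  define w where "w = (\<lambda>k. x (case k of 0 \<Rightarrow> n | Suc k \<Rightarrow> e k))"
  obtain N where N: "\<And>k. k \<ge> N \<Longrightarrow> \<exists>i\<in>{1..N}. dist (w 0) (w i) + dist (w i) (w k) \<le> dist (w 0) (w k) + \<delta>"
    using assms(1,3) unfolding almost_between_def by (force simp: algebra_simps)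
  \<comment> \<open>Every \<open>k \<ge> N\<close> has an intermediate index among the finitely many
    in \<open>{1..N}\<close>, so one index serves infinitely many \<open>k\<close>.\<close>
  have "\<exists>i\<in>{1..N}. infinite {k \<in> {N..}. dist (w 0) (w i) + dist (w i) (w k) \<le> dist (w 0) (w k) + \<delta>}"
    using N by (intro pigeonhole_infinite_rel) (auto simp: infinite_Ici)
  then obtain i where i: "1 \<le> i" "i \<le> N"
    and infK: "infinite {k \<in> {N..}. dist (w 0) (w i) + dist (w i) (w k) \<le> dist (w 0) (w k) + \<delta>}"
    by auto
  let ?K = "{k \<in> {N..}. dist (w 0) (w i) + dist (w i) (w k) \<le> dist (w 0) (w k) + \<delta>}"
  have pos: "k \<ge> 1" if "k \<in> ?K" for k
    using that i by auto
  have w: "w k = x (e (k - 1))" if "k \<ge> 1" for k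
    using that by (simp add: w_def split: nat.split)
  have "inj_on (\<lambda>k. e (k - 1)) ?K"
  proof (rule inj_onI)
    fix k l assume kl: "k \<in> ?K" "l \<in> ?K" "e (k - 1) = e (l - 1)"
    then show "k = l"
      using injD[OF inj kl(3)] pos[OF kl(1)] pos[OF kl(2)] by simp
  qed
  then have "infinite ((\<lambda>k. e (k - 1)) ` ?K)"
    using infK finite_imageD by blast
  moreover have "dist (x n) (x (e (i - 1))) + dist (x (e (i - 1))) (x l) \<le> dist (x n) (x l) + \<delta>"
    if "l \<in> (\<lambda>k. e (k - 1)) ` ?K" for l
  proof -
    from that obtain k where k: "k \<in> ?K" "l = e (k - 1)" by blast
    then show ?thesis
      using w[OF pos[OF k(1)]] w[OF i(1)] by (simp add: w_def)
  qed
  ultimately show ?thesis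
    using e by (intro that[of "e (i - 1)" "(\<lambda>k. e (k - 1)) ` ?K"]) auto
qed

text \<open>Applying the hypothesis repeatedly towards a fixed endpoint \<open>j\<close> bounds the
  length of a path by the distance of its ends plus the sum of the defects along it; far out, that
  sum is below any \<open>\<epsilon>\<close>.\<close>

lemma inline_seq_of_summable_defects:
  fixes u :: "nat \<Rightarrow> 'a::metric_space"
  assumes step: "\<And>k j. k < j \<Longrightarrow> dist (u k) (u (Suc k)) + dist (u (Suc k)) (u j) \<le> dist (u k) (u j) + c k"
    and c: "summable c" "\<And>k. 0 \<le> c k"
  shows "inline_seq u"
  unfolding inline_seq_def
proof (intro allI impI)
  fix \<epsilon> :: real assume "\<epsilon> > 0"
  have len: "(\<Sum>i=k..<j. dist (u i) (u (Suc i))) \<le> dist (u k) (u j) + (\<Sum>i=k..<j. c i)" if "k \<le> j" for k j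
    using that
  proof (induction rule: inc_induct)
    case (step n)
    then show ?case
      using assms(1)[of n j] by (simp add: sum.atLeast_Suc_lessThan)
  qed simp
  obtain N where N: "\<And>n. norm (\<Sum>i=N..<n. c i) < \<epsilon>"
    using c(1) \<open>\<epsilon> > 0\<close> unfolding summable_Cauchy by (meson order_refl)
  have "(\<Sum>i=0..r. dist (u (i + N)) (u (i + 1 + N))) \<le> dist (u (0 + N)) (u (r + 1 + N)) + \<epsilon>" for r
  proof -
    have "(\<Sum>i=0..r. dist (u (i + N)) (u (i + 1 + N))) = (\<Sum>i=0+N..<Suc r+N. dist (u i) (u (Suc i)))"
      unfolding sum.shift_bounds_nat_ivl by (simp add: atLeastLessThanSuc_atLeastAtMost)
    also have "\<dots> \<le> dist (u N) (u (Suc r + N)) + \<epsilon>"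
      using len[of N "Suc r + N"] N[of "Suc r + N"] by simp
    finally show ?thesis by simp
  qed
  then show "\<exists>N. good_inline \<epsilon> (\<lambda>n. u (n + N))"
    unfolding good_inline_def by blast
qed

lemma inline_subseq_of_almost_between:
  fixes x :: "nat \<Rightarrow> 'a::metric_space"
  assumes ab: "almost_between TYPE('a)"
  shows "\<exists>k :: nat \<Rightarrow> nat. strict_mono k \<and> inline_seq (x \<circ> k)"
proof -
  \<comment> \<open>A state is the current index with an infinite set of admissible later indices.
    The next index comes from that set, which then shrinks to indices for which the next point is
    almost between, with defect \<open>(1/2)^k\<close>.\<close>
  define Q where "Q k s t \<longleftrightarrow> fst t \<in> snd s \<and> fst s < fst t \<and> snd t \<subseteq> snd s \<and>
      (\<forall>l\<in>snd t. dist (x (fst s)) (x (fst t)) + dist (x (fst t)) (x l) \<le> dist (x (fst s)) (x l) + (1/2)^k)"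
    for k and s t :: "nat \<times> nat set"
  have "\<exists>s. \<forall>k. infinite (snd (s k)) \<and> Q k (s k) (s (Suc k))"
  proof (rule dependent_nat_choice)
    show "\<exists>s :: nat \<times> nat set. infinite (snd s)"
      by (intro exI[of _ "(0, UNIV)"]) simp
    fix s :: "nat \<times> nat set" and k :: nat assume s: "infinite (snd s)"
    have "(0::real) < (1/2)^k" by simp
    from almost_between_infinite[OF ab s this, of "fst s" x] obtain n' A' where
      "n' \<in> snd s" "fst s < n'" "infinite A'" "A' \<subseteq> snd s"
      "\<And>l. l \<in> A' \<Longrightarrow> dist (x (fst s)) (x n') + dist (x n') (x l) \<le> dist (x (fst s)) (x l) + (1/2)^k"
      by blast
    then show "\<exists>t. infinite (snd t) \<and> Q k s t"
      by (intro exI[of _ "(n', A')"]) (simp add: Q_def)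
  qed
  then obtain s where Q: "\<And>k. Q k (s k) (s (Suc k))"
    by blast
  define m where "m = fst \<circ> s"
  have "strict_mono m"
    using Q by (simp add: strict_mono_Suc_iff Q_def m_def)
  have "decseq (snd \<circ> s)"
    using Q by (intro decseq_SucI) (simp add: Q_def)
  have "dist (x (m k)) (x (m (Suc k))) + dist (x (m (Suc k))) (x (m j)) \<le> dist (x (m k)) (x (m j)) + (1/2)^k"
    if "k < j" for k j
  \<comment> \<open>The index \<open>m (Suc k)\<close> lies in the set of stage \<open>k\<close>,
    and only later indices are sure to lie in that of stage \<open>Suc k\<close>; for
    \<open>j = Suc k\<close> the inequality is trivial.\<close>
  proof (cases "j = Suc k")
    case False
    then have "Suc k \<le> j - 1" "Suc (j - 1) = j"
      using that by auto
    then have "m j \<in> snd (s (Suc k))"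
      using Q[of "j - 1"] decseqD[OF \<open>decseq (snd \<circ> s)\<close> \<open>Suc k \<le> j - 1\<close>] by (auto simp: Q_def m_def)
    then show ?thesis
      using Q[of k] by (simp add: Q_def m_def)
  qed simp
  then have "inline_seq (x \<circ> m)"
    by (intro inline_seq_of_summable_defects[of _ "\<lambda>k. (1/2)^k"]) (auto simp: summable_geometric)
  then show ?thesis
    using \<open>strict_mono m\<close> by blast
qed

section \<open>(d) implies (a) and Heine-Borel: lengths of inline sequences\<close>

lemma good_inline_length:
  assumes "good_inline \<epsilon> u" "\<epsilon> \<ge> 0"
  shows "(\<Sum>i<n. dist (u i) (u (Suc i))) \<le> dist (u 0) (u n) + \<epsilon>"
proof (cases n)
  case (Suc r)
  then show ?thesis
    using assms(1) by (simp add: good_inline_def lessThan_Suc_atMost atMost_atLeast0)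
qed (use assms in simp)

lemma dense_finite_of_inline_subseq:
  assumes inline: "\<And>x :: nat \<Rightarrow> 'a::metric_space. \<exists>k :: nat \<Rightarrow> nat. strict_mono k \<and> inline_seq (x \<circ> k)"
  shows "(katetov :: ('a \<Rightarrow> real) set) = katetov_topology closure_of katetov_finite"
proof (rule ccontr)
  assume neq: "\<not> ?thesis"
  have sub: "(katetov_finite :: ('a \<Rightarrow> real) set) \<subseteq> katetov"
    by (auto simp: katetov_finite_def)
  obtain f :: "'a \<Rightarrow> real" and \<epsilon> where f: "f \<in> katetov" and "\<epsilon> > 0"
    and far: "\<And>g. g \<in> katetov_finite \<Longrightarrow> \<exists>x. \<bar>f x - g x\<bar> > \<epsilon>"
    using neq in_katetov_closure_iff[OF sub] by (auto simp: not_le set_eq_iff)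
  have hyp: "dist (id s) (id t) \<le> f s + f t" and lip: "f s \<le> f t + dist s t" for s t
    using f by (auto simp: katetov_def abs_le_iff algebra_simps)
  \<comment> \<open>The hull of \<open>f\<close> over \<open>S\<close> is finitely controlled and
    lies above \<open>f\<close>, so being far from \<open>f\<close> means exceeding it by more than
    \<open>\<epsilon>\<close> at some point.\<close>
  have next_point: "\<exists>x. \<forall>s\<in>S. f x + \<epsilon> < f s + dist x s" if S: "finite S" for S
  proof (cases "S = {}")
    case False
    obtain x where x: "\<bar>f x - katetov_hull S id f x\<bar> > \<epsilon>"
      using far[OF katetov_hull_self_in_katetov_finite[OF f S False]] by blast
    have "f x \<le> katetov_hull S id f x"
      using lip by (intro katetov_hull_greatest[of S id f, OF False hyp]) auto
    then have "f x + \<epsilon> < f s + dist x s" if "s \<in> S" for s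
      using x katetov_hull_le[of S id f _ x, OF False hyp that] by simp
    then show ?thesis by blast
  qed simp
  have "\<exists>x :: nat \<Rightarrow> 'a. \<forall>n. \<forall>i<n. f (x n) + \<epsilon> < f (x i) + dist (x n) (x i)"
  proof (rule dependent_wellorder_choice[where P = "\<lambda>h n y. \<forall>i<n. f y + \<epsilon> < f (h i) + dist y (h i)"])
    fix n :: nat and h :: "nat \<Rightarrow> 'a"
    show "\<exists>y. \<forall>i<n. f y + \<epsilon> < f (h i) + dist y (h i)"
      using next_point[of "h ` {..<n}"] by (metis finite_imageI finite_lessThan imageI lessThan_iff)
  qed auto
  then obtain x :: "nat \<Rightarrow> 'a" where x: "\<And>i n. i < n \<Longrightarrow> f (x n) + \<epsilon> < f (x i) + dist (x n) (x i)"
    by blast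
  obtain k :: "nat \<Rightarrow> nat" where k: "strict_mono k" "inline_seq (x \<circ> k)"
    using inline by blast
  then obtain N where N: "good_inline 1 (\<lambda>n. x (k (n + N)))"
    by (fastforce simp: inline_seq_def)
  define u where "u n = x (k (n + N))" for n
  have u: "f (u (Suc n)) + \<epsilon> < f (u n) + dist (u n) (u (Suc n))" for n
    using x[of "k (n + N)" "k (Suc n + N)"] k(1) by (simp add: u_def strict_mono_def dist_commute)
  have gain: "f (u n) + n * \<epsilon> \<le> f (u 0) + (\<Sum>i<n. dist (u i) (u (Suc i)))" for n :: nat
  proof (induction n)
    case (Suc n)
    then show ?case
      using u[of n] by (simp add: algebra_simps)
  qed simp
  \<comment> \<open>The length is at most \<open>dist (u 0) (u n) + 1\<close>, hence at most
    \<open>f (u 0) + f (u n) + 1\<close>; the term \<open>f (u n)\<close> cancels against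
    \<open>gain\<close>, leaving a bound independent of \<open>n\<close>.\<close>
  have "n * \<epsilon> \<le> 2 * f (u 0) + 1" for n :: nat
    using gain[of n] good_inline_length[of 1 u n] N hyp[of "u 0" "u n"] by (simp add: u_def[abs_def])
  moreover obtain n :: nat where "2 * f (u 0) + 1 < n * \<epsilon>"
    using reals_Archimedean3[OF \<open>\<epsilon> > 0\<close>] by blast
  ultimately show False
    by (meson not_le)
qed

lemma dist_le_length: "m \<le> n \<Longrightarrow> dist (u m) (u n) \<le> (\<Sum>i=m..<n. dist (u i) (u (Suc i)))"
proof (induction rule: inc_induct)
  case (step m)
  then show ?case
    using dist_triangle[of "u m" "u n" "u (Suc m)"] by (simp add: sum.atLeast_Suc_lessThan)
qed simp

lemma compact_cball_of_inline_subseq: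
  fixes z :: "'a::complete_space"
  assumes inline: "\<And>x :: nat \<Rightarrow> 'a. \<exists>k :: nat \<Rightarrow> nat. strict_mono k \<and> inline_seq (x \<circ> k)"
  shows "compact (cball z r)"
  unfolding compact_eq_seq_compact_metric seq_compact_def
proof (intro allI impI)
  fix x :: "nat \<Rightarrow> 'a" assume x: "\<forall>n. x n \<in> cball z r"
  obtain k :: "nat \<Rightarrow> nat" where k: "strict_mono k" "inline_seq (x \<circ> k)"
    using inline by blast
  then obtain N where N: "good_inline 1 (\<lambda>n. x (k (n + N)))"
    by (fastforce simp: inline_seq_def)
  define u where "u n = x (k (n + N))" for n
  have "dist (u 0) (u n) \<le> 2 * r" for n
    using x dist_triangle3[of "u 0" "u n" z] by (simp add: u_def) (smt (verit))
  \<comment> \<open>Boundedness and inlineness with error 1 bound all partial lengths, so the steps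
    are summable and the tail is Cauchy.\<close>
  then have "(\<Sum>i<n. dist (u i) (u (Suc i))) \<le> 2 * r + 1" for n
    using good_inline_length[of 1 u n] N by (simp add: u_def[abs_def]) (smt (verit))
  then have "summable (\<lambda>i. dist (u i) (u (Suc i)))"
    by (intro summableI_nonneg_bounded) auto
  then have small: "\<exists>M. \<forall>m\<ge>M. \<forall>n. norm (\<Sum>i=m..<n. dist (u i) (u (Suc i))) < e" if "e > 0" for e
    using that unfolding summable_Cauchy by blast
  have "Cauchy u"
    unfolding Cauchy_altdef
  proof (intro allI impI)
    fix e :: real assume "e > 0"
    then obtain M where M: "\<forall>m\<ge>M. \<forall>n. norm (\<Sum>i=m..<n. dist (u i) (u (Suc i))) < e"
      using small by blast
    have "dist (u m) (u n) < e" if "m \<ge> M" "n > m" for m n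
      using dist_le_length[of m n u] M[rule_format, OF that(1), of n] that(2)
      unfolding real_norm_def by linarith
    then show "\<exists>M. \<forall>m\<ge>M. \<forall>n>m. dist (u m) (u n) < e"
      by blast
  qed
  then obtain l where l: "u \<longlonglongrightarrow> l"
    by (auto simp: Cauchy_convergent_iff convergent_def)
  have "u n \<in> cball z r" for n
    using x unfolding u_def by blast
  from closed_sequentially[OF closed_cball this l] have "l \<in> cball z r" .
  moreover have "(x \<circ> k) \<longlonglongrightarrow> l"
    by (rule LIMSEQ_offset[of _ N]) (use l in \<open>simp add: u_def[abs_def]\<close>)
  ultimately show "\<exists>l\<in>cball z r. \<exists>k. strict_mono k \<and> (x \<circ> k) \<longlonglongrightarrow> l"
    using k(1) by blast
qed

theorem theorem4p5:
  shows
    "let a = ((katetov :: ('a::polish_space \<Rightarrow> real) set) = katetov_topology closure_of katetov_finite);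
         b = separable_space (katetov_topology :: ('a \<Rightarrow> real) topology);
         c = ((\<forall>(z::'a) (r::real). compact (cball z r)) \<and>
              (\<forall>\<delta>>0. \<forall>x :: nat \<Rightarrow> 'a. \<exists>N. \<forall>n\<ge>N. \<exists>i. 1 \<le> i \<and> i \<le> N \<and>
                 dist (x 0) (x n) \<ge> dist (x 0) (x i) + dist (x i) (x n) - \<delta>));
         d = (\<forall>x :: nat \<Rightarrow> 'a. \<exists>k :: nat \<Rightarrow> nat. strict_mono k \<and> inline_seq (x \<circ> k))
     in (a \<longleftrightarrow> b) \<and> (b \<longleftrightarrow> c) \<and> (c \<longleftrightarrow> d)"
proof -
  let ?d = "\<forall>x :: nat \<Rightarrow> 'a. \<exists>k :: nat \<Rightarrow> nat. strict_mono k \<and> inline_seq (x \<circ> k)"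
  let ?a = "(katetov :: ('a \<Rightarrow> real) set) = katetov_topology closure_of katetov_finite"
  let ?b = "separable_space (katetov_topology :: ('a \<Rightarrow> real) topology)"
  have "?a \<Longrightarrow> ?b"
    by (rule separable_katetov_of_dense_finite)
  moreover have "?b \<Longrightarrow> almost_between TYPE('a)"
    by (rule almost_between_of_separable_katetov)
  moreover have "almost_between TYPE('a) \<Longrightarrow> ?d"
    using inline_subseq_of_almost_between by blast
  moreover have "?d \<Longrightarrow> ?a"
    by (rule dense_finite_of_inline_subseq) blast
  moreover have "?d \<Longrightarrow> \<forall>(z::'a) (r::real). compact (cball z r)"
    using compact_cball_of_inline_subseq by blast
  ultimately show ?thesis
    \<comment> \<open>Folding the second half of (c) into \<open>almost_between\<close> leaves a
      propositional argument.\<close>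
    unfolding Let_def almost_between_def[of "TYPE('a)", symmetric] by blast
qed

end
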